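(* Let $\gamma\in(0,1)$. If the Hamilton–Jacobi–Bellman equation $$\alpha\,v_*(x)=\max_{u\in\mathcal U}h(x,u,\nabla v_*(x))\qquad\forall x\in\mathcal X$$ has a bounded $\mathrm C^1$ solution $v_*:\mathcal X\to\mathbb R$, then for any policy $\pi_*$ satisfying $\pi_*(x)\in\arg\max_{u\in\mathcal U}h(x,u,\nabla v_*(x))$ for all $x\in\mathcal X$: (1) $v_{\pi_*}$ is bounded (hence, admissible) and $v_*=v_{\pi_*}$; (2) $\pi\preccurlyeq\pi_*$ for any policy $\pi$, i.e., $v_\pi(x)\le v_{\pi_*}(x)$ for all $x\in\mathcal X$. Moreover, $v_*$ is the unique solution of the Hamilton–Jacobi–Bellman equation over all bounded $\mathrm C^1$ functions $v:\mathcal X\to\mathbb R$.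
   Context: State space $\mathcal X=\mathbb R^l$, $\mathcal X^{\mathsf T}=\mathbb R^{1\times l}$, time space $\mathbb T=[0,\infty)$. The action space $\mathcal U\subseteq\mathbb R^m$ is an $m$-dimensional manifold with or without boundary, meaning $\mathcal U=O\cup\partial O$ or $\mathcal U=O$ for some open $O\subseteq\mathbb R^m$. The environment is $\dot X_t=f(X_t,U_t)$, with $f:\mathcal X\times\mathcal U\to\mathcal X$ continuous and $t\mapsto U_t\in\mathcal U$ continuous; it is a standing assumption that the state trajectory $t\mapsto X_t$ is uniquely defined over all of $\mathbb T$ (for every initial state, in particular under every policy). A policy is a continuous function $\pi:\mathcal X\to\mathcal U$. $\mathbb G_\pi^x[Y]$ denotes the value of $Y$ when $X_0=x$ and $U_t=\pi(X_t)$ for all $t\in\mathbb T$. The reward function $r:\mathcal X\times\mathcal U\to\mathbb R$ is continuous and attains a maximum (standing assumption), $R_t=r(X_t,U_t)$; $\gamma$ is the discount factor and $\alpha=-\ln\gamma$. The value function (VF) of $\pi$ is $v_\pi(x)=\mathbb G_\pi^x[\int_0^\infty\gamma^tR_t\,dt]\in[-\infty,\infty)$. A policy $\pi$ (and its VF) is admissible iff $v_\pi(x)$ is finite for all $x\in\mathcal X$. Standing assumption: at least one admissible policy exists, and every admissible VF is $\mathrm C^1$. Gradients are row vectors, and the Hamiltonian is $h(x,u,p)=r(x,u)+p\,f(x,u)$. Standing assumption: there is a continuous $u_*:\mathcal X\times\mathcal X^{\mathsf T}\to\mathcal U$ with $u_*(x,p)\in\arg\max_{u\in\mathcal U}h(x,u,p)$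 for all $(x,p)$. *)

theory Defs
  imports "HOL-Analysis.Analysis"
begin

text \<open>
  States are vectors of type \<open>real ^ 'l\<close> and actions are vectors of type \<open>real ^ 'm\<close>; \<open>f\<close> and
  \<open>r\<close> are total functions of which only the values at actions in \<open>U\<close> matter.
  A row vector \<open>p\<close> of size \<open>1 \<times> l\<close> is identified with a vector of type \<open>real ^ 'l\<close>, so that the
  product of the row \<open>p\<close> and the column \<open>f x u\<close> is the inner product \<open>p \<bullet> f x u\<close>.
\<close>

definition is_maximum :: "('a \<Rightarrow> real) \<Rightarrow> 'a set \<Rightarrow> real \<Rightarrow> bool" where
  "is_maximum g S M \<longleftrightarrow> (\<exists>z. is_arg_max g (\<lambda>z. z \<in> S) z \<and> g z = M)"

definition gradient :: "(real ^ 'l \<Rightarrow> real) \<Rightarrow> real ^ 'l \<Rightarrow> real ^ 'l" where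
  "gradient v x = (THE p. GDERIV v x :> p)"

definition C1_function :: "(real ^ 'l \<Rightarrow> real) \<Rightarrow> bool" where
  "C1_function v \<longleftrightarrow> (\<forall>x. v differentiable (at x)) \<and> continuous_on UNIV (gradient v)"

definition manifold_with_or_without_boundary :: "(real ^ 'm) set \<Rightarrow> bool" where
  "manifold_with_or_without_boundary U \<longleftrightarrow>
     (\<exists>G. open G \<and> (U = G \<or> U = G \<union> frontier G))"

definition is_policy :: "(real ^ 'm) set \<Rightarrow> (real ^ 'l \<Rightarrow> real ^ 'm) \<Rightarrow> bool" where
  "is_policy U \<pi> \<longleftrightarrow> continuous_on UNIV \<pi> \<and> (\<forall>x. \<pi> x \<in> U)"

definition is_action_trajectory :: "(real ^ 'm) set \<Rightarrow> (real \<Rightarrow> real ^ 'm) \<Rightarrow> bool" where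
  "is_action_trajectory U a \<longleftrightarrow> continuous_on {0..} a \<and> (\<forall>t\<ge>0. a t \<in> U)"

text \<open>At time 0 the derivative is one-sided; values at negative times are irrelevant.\<close>

definition is_state_trajectory ::
  "(real ^ 'l \<Rightarrow> real ^ 'm \<Rightarrow> real ^ 'l) \<Rightarrow> real ^ 'l \<Rightarrow> (real \<Rightarrow> real ^ 'm)
     \<Rightarrow> (real \<Rightarrow> real ^ 'l) \<Rightarrow> bool" where
  "is_state_trajectory f x a X \<longleftrightarrow>
     X 0 = x \<and> (\<forall>t\<ge>0. (X has_vector_derivative f (X t) (a t)) (at t within {0..}))"

definition is_policy_trajectory ::
  "(real ^ 'l \<Rightarrow> real ^ 'm \<Rightarrow> real ^ 'l) \<Rightarrow> (real ^ 'l \<Rightarrow> real ^ 'm) \<Rightarrow> real ^ 'l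
     \<Rightarrow> (real \<Rightarrow> real ^ 'l) \<Rightarrow> bool" where
  "is_policy_trajectory f \<pi> x X \<longleftrightarrow> is_state_trajectory f x (\<lambda>t. \<pi> (X t)) X"

definition uniquely_defined :: "((real \<Rightarrow> real ^ 'l) \<Rightarrow> bool) \<Rightarrow> bool" where
  "uniquely_defined P \<longleftrightarrow> (\<exists>X. P X \<and> (\<forall>Y. P Y \<longrightarrow> (\<forall>t\<ge>0. Y t = X t)))"

text \<open>
  Under the standing assumptions below, the choice operator only leaves the values at negative
  times undetermined.
\<close>

definition policy_trajectory ::
  "(real ^ 'l \<Rightarrow> real ^ 'm \<Rightarrow> real ^ 'l) \<Rightarrow> (real ^ 'l \<Rightarrow> real ^ 'm) \<Rightarrow> real ^ 'l
     \<Rightarrow> real \<Rightarrow> real ^ 'l" where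
  "policy_trajectory f \<pi> x = (SOME X. is_policy_trajectory f \<pi> x X)"

text \<open>
  The extended Lebesgue integral over \<open>[0, \<infinity>)\<close>: integral of the positive part minus integral of
  the negative part. For a discounted reward that is bounded above, with a discount factor in
  \<open>(0, 1)\<close>, the first term is finite, so the difference is never of the form \<open>\<infinity> - \<infinity>\<close>.
\<close>

definition time_integral :: "(real \<Rightarrow> real) \<Rightarrow> ereal" where
  "time_integral g =
     enn2ereal (\<integral>\<^sup>+ t\<in>{0..}. ennreal (g t) \<partial>lborel) -
     enn2ereal (\<integral>\<^sup>+ t\<in>{0..}. ennreal (- g t) \<partial>lborel)"

definition value_function ::
  "(real ^ 'l \<Rightarrow> real ^ 'm \<Rightarrow> real ^ 'l) \<Rightarrow> (real ^ 'l \<Rightarrow> real ^ 'm \<Rightarrow> real) \<Rightarrow> real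
     \<Rightarrow> (real ^ 'l \<Rightarrow> real ^ 'm) \<Rightarrow> real ^ 'l \<Rightarrow> ereal" where
  "value_function f r \<gamma> \<pi> x =
     (let X = policy_trajectory f \<pi> x
      in time_integral (\<lambda>t. \<gamma> powr t * r (X t) (\<pi> (X t))))"

definition admissible ::
  "(real ^ 'm) set \<Rightarrow> (real ^ 'l \<Rightarrow> real ^ 'm \<Rightarrow> real ^ 'l) \<Rightarrow> (real ^ 'l \<Rightarrow> real ^ 'm \<Rightarrow> real)
     \<Rightarrow> real \<Rightarrow> (real ^ 'l \<Rightarrow> real ^ 'm) \<Rightarrow> bool" where
  "admissible U f r \<gamma> \<pi> \<longleftrightarrow>
     is_policy U \<pi> \<and> (\<forall>x. \<bar>value_function f r \<gamma> \<pi> x\<bar> \<noteq> \<infinity>)"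

definition hamiltonian ::
  "(real ^ 'l \<Rightarrow> real ^ 'm \<Rightarrow> real ^ 'l) \<Rightarrow> (real ^ 'l \<Rightarrow> real ^ 'm \<Rightarrow> real)
     \<Rightarrow> real ^ 'l \<Rightarrow> real ^ 'm \<Rightarrow> real ^ 'l \<Rightarrow> real" where
  "hamiltonian f r x u p = r x u + p \<bullet> f x u"

definition HJB_solution ::
  "(real ^ 'm) set \<Rightarrow> (real ^ 'l \<Rightarrow> real ^ 'm \<Rightarrow> real ^ 'l) \<Rightarrow> (real ^ 'l \<Rightarrow> real ^ 'm \<Rightarrow> real)
     \<Rightarrow> real \<Rightarrow> (real ^ 'l \<Rightarrow> real) \<Rightarrow> bool" where
  "HJB_solution U f r \<gamma> v \<longleftrightarrow>
     (\<forall>x. is_maximum (\<lambda>u. hamiltonian f r x u (gradient v x)) U (- ln \<gamma> * v x))"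

locale control_problem =
  fixes U :: "(real ^ 'm) set"
    and f :: "real ^ 'l \<Rightarrow> real ^ 'm \<Rightarrow> real ^ 'l"
    and r :: "real ^ 'l \<Rightarrow> real ^ 'm \<Rightarrow> real"
    and \<gamma> :: real
  assumes action_space: "manifold_with_or_without_boundary U"
    and f_continuous: "continuous_on (UNIV \<times> U) (\<lambda>(x, u). f x u)"
    and state_trajectory_unique:
      "\<And>a x. is_action_trajectory U a \<Longrightarrow> uniquely_defined (is_state_trajectory f x a)"
    and policy_trajectory_unique:
      "\<And>\<pi> x. is_policy U \<pi> \<Longrightarrow> uniquely_defined (is_policy_trajectory f \<pi> x)"
    and r_continuous: "continuous_on (UNIV \<times> U) (\<lambda>(x, u). r x u)"
    and r_attains_maximum: "\<exists>M. is_maximum (\<lambda>(x, u). r x u) (UNIV \<times> U) M"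
    and admissible_exists: "\<exists>\<pi>. admissible U f r \<gamma> \<pi>"
    and admissible_C1:
      "\<And>\<pi>. admissible U f r \<gamma> \<pi> \<Longrightarrow> C1_function (\<lambda>x. real_of_ereal (value_function f r \<gamma> \<pi> x))"
    and maximizer_exists:
      "\<exists>u_max. continuous_on UNIV (\<lambda>(x, p). u_max x p) \<and>
         (\<forall>x p. is_arg_max (\<lambda>u. hamiltonian f r x u p) (\<lambda>u. u \<in> U) (u_max x p))"

end

theory Submission
  imports Defs
begin

text \<open>
  Along a trajectory \<open>X\<close> of a policy, \<open>w t = \<gamma>\<^sup>t v (X t)\<close> has derivative
  \<open>\<gamma>\<^sup>t (ln \<gamma> v + \<nabla>v \<bullet> f)\<close>. The Hamilton--Jacobi--Bellman equation bounds this from above by minus the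
  discounted reward, with equality when the policy maximizes the Hamiltonian. As \<open>v\<close> is bounded,
  \<open>w\<close> vanishes at infinity, so integrating gives \<open>v\<^sub>\<pi> x \<le> w 0 = v x\<close>, with equality for
  maximizing policies. For uniqueness, the continuous maximizer \<open>u\<^sub>*(x, \<nabla>v x)\<close> is a
  policy whose value is \<open>v\<close>, hence \<open>v\<close> lies below every other bounded solution.
\<close>

section \<open>Improper integrals over a half-line\<close>

lemma nn_integral_FTC_atLeast_within:
  fixes F q :: "real \<Rightarrow> real"
  assumes q: "continuous_on {a..} q" "\<And>t. a \<le> t \<Longrightarrow> 0 \<le> q t"
    and F: "\<And>t. a \<le> t \<Longrightarrow> (F has_real_derivative q t) (at t within {a..})"
    and lim: "(F \<longlongrightarrow> T) at_top"
  shows "(\<integral>\<^sup>+t\<in>{a..}. ennreal (q t) \<partial>lborel) = ennreal (T - F a)"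
proof -
  \<comment> \<open>The library version needs a two-sided derivative at \<open>a\<close>: extend \<open>F\<close> linearly to the left.\<close>
  define G where "G t = (if t \<in> {a..} then F t else F a + (t - a) * q a)" for t
  \<comment> \<open>Freezing \<open>q\<close> at \<open>q a\<close> to the left of \<open>a\<close>
    makes it Borel measurable on the whole line and leaves it unchanged on
    \<open>{a..}\<close>.\<close>
  have "continuous_on UNIV (\<lambda>t. q (max a t))"
    by (rule continuous_on_compose2[OF q(1)]) (auto intro!: continuous_intros)
  then have qb: "(\<lambda>t. q (max a t)) \<in> borel_measurable borel"
    by (rule borel_measurable_continuous_onI)
  have G: "(G has_real_derivative q (max a t)) (at t)" if "a \<le> t" for t
  proof -
    have "((\<lambda>t. F a + (t - a) * q a) has_vector_derivative q a) (at t within {..a})"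
      unfolding has_real_derivative_iff_has_vector_derivative[symmetric]
      by (auto intro!: derivative_eq_intros)
    \<comment> \<open>The two pieces meet only at \<open>a\<close>, where both have value
      \<open>F a\<close> and slope \<open>q a\<close>, so the one-sided derivatives glue to a
      two-sided one.\<close>
    then have "(G has_vector_derivative (if t \<in> {a..} then q t else q a)) (at t within UNIV)"
      unfolding G_def using F that
      by (intro has_vector_derivative_If_within_closures[where T = "{..a}"])
         (auto simp: has_real_derivative_iff_has_vector_derivative closure_closed
               intro: has_vector_derivative_within_subset)
    then show ?thesis
      using that by (simp add: has_real_derivative_iff_has_vector_derivative max_def)
  qed
  have "(G \<longlongrightarrow> T) at_top"
    using lim by (rule Lim_transform_eventually) (auto simp: G_def eventually_at_top_linorder)
  then have "(\<integral>\<^sup>+t\<in>{a..}. ennreal (q (max a t)) \<partial>lborel) = ennreal (T - G a)"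
    using G q(2) by (intro nn_integral_FTC_atLeast[OF qb]) auto
  moreover have "(\<integral>\<^sup>+t\<in>{a..}. ennreal (q (max a t)) \<partial>lborel) = (\<integral>\<^sup>+t\<in>{a..}. ennreal (q t) \<partial>lborel)"
    by (intro nn_integral_cong) (auto simp: indicator_def max_def)
  ultimately show ?thesis
    by (simp add: G_def)
qed

lemma set_borel_measurable_continuous_lborel:
  fixes g :: "real \<Rightarrow> real"
  assumes "continuous_on {a..} g"
  shows "(\<lambda>t. indicator {a..} t * g t) \<in> borel_measurable lborel"
  using borel_measurable_continuous_on_indicator[of "{a..}" g] assms by simp

lemma ennreal_indicator_mult: "ennreal (indicator A t * x) = ennreal x * indicator A t"
  by (auto simp: indicator_def)

text \<open>Links Bochner integrability to finiteness of the two terms of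
  \<open>time_integral\<close>; continuity supplies the measurability.\<close>

lemma set_integrable_lborel_iff:
  fixes g :: "real \<Rightarrow> real"
  assumes "continuous_on {a..} g"
  shows "set_integrable lborel {a..} g \<longleftrightarrow>
    (\<integral>\<^sup>+t\<in>{a..}. ennreal (g t) \<partial>lborel) \<noteq> \<infinity> \<and> (\<integral>\<^sup>+t\<in>{a..}. ennreal (- g t) \<partial>lborel) \<noteq> \<infinity>"
proof -
  have "ennreal (- (indicator {a..} t * g t)) = ennreal (- g t) * indicator {a..} t" for t
    by (auto simp: indicator_def)
  then show ?thesis
    using set_borel_measurable_continuous_lborel[OF assms]
    by (simp add: set_integrable_def real_integrable_def ennreal_indicator_mult)
qed

lemma set_integrable_FTC_atLeast_within:
  fixes F q :: "real \<Rightarrow> real"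
  assumes q: "continuous_on {a..} q" "\<And>t. a \<le> t \<Longrightarrow> 0 \<le> q t"
    and F: "\<And>t. a \<le> t \<Longrightarrow> (F has_real_derivative q t) (at t within {a..})"
    and lim: "(F \<longlongrightarrow> T) at_top"
  shows "set_integrable lborel {a..} q"
proof -
  have "(\<integral>\<^sup>+t\<in>{a..}. ennreal (- q t) \<partial>lborel) = (\<integral>\<^sup>+t. 0 \<partial>(lborel :: real measure))"
    using q(2) by (intro nn_integral_cong) (auto simp: indicator_def ennreal_neg)
  then show ?thesis
    using nn_integral_FTC_atLeast_within[OF assms] by (simp add: set_integrable_lborel_iff[OF q(1)])
qed

text \<open>Integrability makes both terms finite, so the subtraction in \<open>ereal\<close> is
  ordinary real subtraction.\<close>

lemma time_integral_eq:
  assumes "set_integrable lborel {0..} g"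
  shows "time_integral g = ereal (LINT t:{0..}|lborel. g t)"
proof -
  let ?g = "\<lambda>t. indicator {0..} t * g t"
  have i: "integrable lborel ?g"
    using assms by (simp add: set_integrable_def)
  have *: "enn2ereal N = ereal (enn2real N)" if "N \<noteq> \<infinity>" for N
    using that by (cases N) (auto simp: enn2ereal_ennreal)
  have neg: "ennreal (- ?g t) = ennreal (- g t) * indicator {0..} t" for t
    by (auto simp: indicator_def)
  show ?thesis
    using i unfolding time_integral_def set_lebesgue_integral_def
    by (simp add: real_lebesgue_integral_def[OF i] * real_integrable_def neg ennreal_indicator_mult)
qed

text \<open>Truncate to \<open>{0..T}\<close>, where the fundamental theorem of calculus bounds the
  integral by \<open>w 0 - w T\<close>, and let \<open>T\<close> tend to infinity.\<close>

lemma set_integral_atLeast_le: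
  fixes g w :: "real \<Rightarrow> real"
  assumes g: "set_integrable lborel {0..} g"
    and w: "\<And>t. 0 \<le> t \<Longrightarrow> (w has_real_derivative w' t) (at t within {0..})"
    and gw: "\<And>t. 0 \<le> t \<Longrightarrow> g t \<le> - w' t"
    and lim: "(w \<longlongrightarrow> 0) at_top"
  shows "(LINT t:{0..}|lborel. g t) \<le> w 0"
proof -
  let ?I = "\<lambda>T. LINT t:{0..T}|lborel. g t"
  \<comment> \<open>The cut-off by \<open>{..T}\<close> is separated from the restriction to
    \<open>{0..}\<close>, so that convergence as \<open>T\<close> grows applies to one fixed
    integrable function.\<close>
  have "?I = (\<lambda>T. LINT t|lborel. indicator {..T} t *\<^sub>R (indicator {0..} t *\<^sub>R g t))"
    by (auto simp: set_lebesgue_integral_def indicator_def fun_eq_iff intro!: Bochner_Integration.integral_cong)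
  then have I: "(?I \<longlongrightarrow> (LINT t:{0..}|lborel. g t)) at_top"
    using tendsto_integral_at_top[of lborel "\<lambda>t. indicator {0..} t *\<^sub>R g t"] g
    by (simp add: set_integrable_def set_lebesgue_integral_def)
  have "((\<lambda>T. w 0 - w T) \<longlongrightarrow> w 0 - 0) at_top"
    by (intro tendsto_intros lim)
  moreover have "?I T \<le> w 0 - w T" if "0 \<le> T" for T
  proof -
    have gT: "set_integrable lborel {0..T} g"
      by (rule set_integrable_subset[OF g]) auto
    have "(w has_vector_derivative w' t) (at t within {0..T})" if "t \<in> {0..T}" for t
      using w[of t] that
      by (intro has_vector_derivative_within_subset[where S = "{0..}" and T = "{0..T}"])
         (simp_all add: has_real_derivative_iff_has_vector_derivative)
    \<comment> \<open>The comparison is made with gauge integrals: there every derivative is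
      integrable, so nothing has to be known about the regularity of \<open>w'\<close>.\<close>
    then have "(w' has_integral w T - w 0) {0..T}"
      using that by (intro fundamental_theorem_of_calculus)
    then have "((\<lambda>t. - w' t) has_integral - (w T - w 0)) {0..T}"
      by (rule has_integral_neg)
    moreover have "(g has_integral ?I T) {0..T}"
      using set_borel_integral_eq_integral[OF gT] by (simp add: integrable_integral)
    ultimately have "?I T \<le> - (w T - w 0)"
      using gw by - (rule has_integral_le, assumption, assumption, simp)
    then show ?thesis by simp
  qed
  then have "\<forall>\<^sub>F T in at_top. ?I T \<le> w 0 - w T"
    by (auto simp: eventually_at_top_linorder)
  ultimately show ?thesis
    by (intro tendsto_le[OF _ _ I, of "\<lambda>T. w 0 - w T" "w 0"]) simp_all
qed

section \<open>Gradients and discounting\<close>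

lemma GDERIV_gradient:
  fixes v :: "real ^ 'l \<Rightarrow> real"
  assumes "v differentiable (at x)"
  shows "GDERIV v x :> gradient v x"
proof -
  obtain D where D: "(v has_derivative D) (at x)"
    using assms by (auto simp: differentiable_def)
  \<comment> \<open>\<open>adjoint D 1\<close> is the Riesz vector of the functional
    \<open>D\<close>. Uniqueness of the derivative makes it the only gradient, so the
    \<open>THE\<close> in \<open>gradient\<close> is well defined.\<close>
  have "D = (\<lambda>h. h \<bullet> adjoint D 1)"
    using adjoint_works[OF has_derivative_linear[OF D]] by (auto simp: fun_eq_iff)
  then have G: "GDERIV v x :> adjoint D 1"
    using D by (simp add: gderiv_def)
  moreover have "p = adjoint D 1" if "GDERIV v x :> p" for p
  proof -
    have "(\<lambda>h. h \<bullet> p) = (\<lambda>h. h \<bullet> adjoint D 1)"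
      using that G unfolding gderiv_def by (rule has_derivative_unique)
    then show ?thesis
      by (simp add: fun_eq_iff vector_eq_ldot)
  qed
  ultimately show ?thesis
    unfolding gradient_def by (rule theI[where P = "\<lambda>p. GDERIV v x :> p"])
qed

lemma tendsto_powr_at_top_0:
  fixes \<gamma> :: real
  assumes "0 < \<gamma>" "\<gamma> < 1"
  shows "((\<lambda>t. \<gamma> powr t) \<longlongrightarrow> 0) at_top"
proof -
  have "filterlim (\<lambda>t. ln \<gamma> * t) at_bot at_top"
    using assms by (intro filterlim_tendsto_neg_mult_at_bot[OF tendsto_const] filterlim_ident) auto
  then show ?thesis
    using assms filterlim_compose[OF exp_at_bot] by (simp add: powr_def mult.commute)
qed

lemma has_real_derivative_const_powr:
  fixes c :: real
  assumes "0 < c"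
  shows "((\<lambda>t. c powr t) has_real_derivative c powr t * ln c) (at t within S)"
  unfolding powr_def using assms by (auto intro!: derivative_eq_intros)

text \<open>The antiderivative \<open>\<gamma> powr t / ln \<gamma>\<close> vanishes at infinity.
  Multiples of the discount will serve as integrable majorants of the discounted reward.\<close>

lemma set_integrable_discount:
  fixes \<gamma> :: real
  assumes "0 < \<gamma>" "\<gamma> < 1"
  shows "set_integrable lborel {0..} (\<lambda>t. \<gamma> powr t)"
proof (rule set_integrable_FTC_atLeast_within)
  show "((\<lambda>t. \<gamma> powr t / ln \<gamma>) has_real_derivative \<gamma> powr t) (at t within {0..})" for t
    using DERIV_cdivide[OF has_real_derivative_const_powr, of \<gamma> "ln \<gamma>"] assms by simp
  show "((\<lambda>t. \<gamma> powr t / ln \<gamma>) \<longlongrightarrow> 0 / ln \<gamma>) at_top"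
    using assms by (intro tendsto_divide tendsto_powr_at_top_0) auto
qed (use assms in \<open>auto intro!: continuous_intros\<close>)

section \<open>Extended-valued integrals controlled by a function vanishing at infinity\<close>

lemma time_integral_le:
  fixes g w :: "real \<Rightarrow> real"
  assumes g: "continuous_on {0..} g" "\<And>t. 0 \<le> t \<Longrightarrow> g t \<le> p t"
    and p: "set_integrable lborel {0..} p"
    and w: "\<And>t. 0 \<le> t \<Longrightarrow> (w has_real_derivative w' t) (at t within {0..})"
    and gw: "\<And>t. 0 \<le> t \<Longrightarrow> g t \<le> - w' t"
    and lim: "(w \<longlongrightarrow> 0) at_top"
  shows "time_integral g \<le> ereal (w 0)"
proof (cases "set_integrable lborel {0..} g")
  case True
  then show ?thesis
    using set_integral_atLeast_le[OF True w gw lim] by (simp add: time_integral_eq)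
next
  case False
  \<comment> \<open>The majorant \<open>p\<close> keeps the positive part finite, so
    non-integrability can only come from the negative part. The integral is then
    \<open>-\<infinity>\<close> and the bound is trivial.\<close>
  have "(\<integral>\<^sup>+t\<in>{0..}. ennreal (g t) \<partial>lborel) \<le> (\<integral>\<^sup>+t. ennreal (indicator {0..} t * p t) \<partial>lborel)"
    using g(2) by (intro nn_integral_mono) (auto simp: indicator_def intro: ennreal_leI)
  also have "\<dots> < \<infinity>"
    using p by (simp add: set_integrable_def real_integrable_def top.not_eq_extremum)
  finally have P: "(\<integral>\<^sup>+t\<in>{0..}. ennreal (g t) \<partial>lborel) < \<infinity>" .
  with False have "(\<integral>\<^sup>+t\<in>{0..}. ennreal (- g t) \<partial>lborel) = \<infinity>"
    by (auto simp: set_integrable_lborel_iff[OF g(1)])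
  moreover obtain c where "(\<integral>\<^sup>+t\<in>{0..}. ennreal (g t) \<partial>lborel) = ennreal c" "0 \<le> c"
    using P by (cases "\<integral>\<^sup>+t\<in>{0..}. ennreal (g t) \<partial>lborel") auto
  ultimately show ?thesis
    by (simp add: time_integral_def)
qed

lemma time_integral_FTC:
  fixes g w :: "real \<Rightarrow> real"
  assumes g: "continuous_on {0..} g" "\<And>t. 0 \<le> t \<Longrightarrow> g t \<le> P' t"
    and P: "continuous_on {0..} P'" "set_integrable lborel {0..} P'"
      "\<And>t. 0 \<le> t \<Longrightarrow> (P has_real_derivative P' t) (at t within {0..})" "(P \<longlongrightarrow> L) at_top"
    and w: "\<And>t. 0 \<le> t \<Longrightarrow> (w has_real_derivative - g t) (at t within {0..})"
    and lim: "(w \<longlongrightarrow> 0) at_top"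
  shows "time_integral g = ereal (w 0)"
proof -
  \<comment> \<open>The gap \<open>P' - g\<close> is nonnegative with convergent antiderivative \<open>P + w\<close>; this rules out
    the value \<open>-\<infinity>\<close>.\<close>
  have "set_integrable lborel {0..} (\<lambda>t. P' t - g t)"
  proof (rule set_integrable_FTC_atLeast_within)
    show "((\<lambda>t. P t + w t) has_real_derivative P' t - g t) (at t within {0..})" if "0 \<le> t" for t
      using DERIV_add[OF P(3) w] that by simp
    show "((\<lambda>t. P t + w t) \<longlongrightarrow> L + 0) at_top"
      by (intro tendsto_add P lim)
  qed (use g P in \<open>auto intro!: continuous_intros\<close>)
  then have "set_integrable lborel {0..} (\<lambda>t. P' t - (P' t - g t))"
    by (rule set_integral_diff(1)[OF P(2)])
  then have i: "set_integrable lborel {0..} g"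
    by simp
  \<comment> \<open>Since the derivative of \<open>w\<close> is exactly \<open>- g\<close>, the
    one-sided estimate applies to \<open>g\<close>, \<open>w\<close> and also to \<open>- g\<close>,
    \<open>- w\<close>; together they give equality.\<close>
  have "(LINT t:{0..}|lborel. g t) \<le> w 0"
    by (rule set_integral_atLeast_le[OF i w _ lim]) auto
  moreover have "(LINT t:{0..}|lborel. - g t) \<le> - w 0"
  proof (rule set_integral_atLeast_le)
    show "((\<lambda>t. - w t) has_real_derivative g t) (at t within {0..})" if "0 \<le> t" for t
      using DERIV_minus[OF w] that by simp
    show "((\<lambda>t. - w t) \<longlongrightarrow> 0) at_top"
      using tendsto_minus[OF lim] by simp
    show "set_integrable lborel {0..} (\<lambda>t. - g t)"
      using i by (simp add: set_integrable_def)
  qed auto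
  ultimately show ?thesis
    by (simp add: time_integral_eq[OF i] set_lebesgue_integral_def)
qed

section \<open>Discounted functions along a trajectory\<close>

lemma has_real_derivative_discounted_trajectory:
  fixes v :: "real ^ 'l \<Rightarrow> real"
  assumes "0 < \<gamma>" and v: "v differentiable (at (X t))"
    and X: "(X has_vector_derivative X') (at t within S)"
  shows "((\<lambda>t. \<gamma> powr t * v (X t)) has_real_derivative
    \<gamma> powr t * (ln \<gamma> * v (X t) + gradient v (X t) \<bullet> X')) (at t within S)"
proof -
  have "(v has_derivative (\<lambda>h. h \<bullet> gradient v (X t))) (at (X t) within X ` S)"
    using GDERIV_gradient[OF v] by (simp add: gderiv_def has_derivative_at_withinI)
  then have "((v \<circ> X) has_real_derivative gradient v (X t) \<bullet> X') (at t within S)"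
    using vector_derivative_diff_chain_within[OF X]
    by (simp add: has_real_derivative_iff_has_vector_derivative inner_commute)
  from DERIV_mult[OF has_real_derivative_const_powr[OF assms(1)] this] show ?thesis
    by (simp add: o_def algebra_simps)
qed

text \<open>The trajectory may leave every bounded set, so the decay rests on a bound for
  \<open>v\<close> over the whole space.\<close>

lemma tendsto_discounted_bounded:
  fixes v :: "'a \<Rightarrow> real"
  assumes "0 < \<gamma>" "\<gamma> < 1" "bounded (range v)"
  shows "((\<lambda>t. \<gamma> powr t * v (X t)) \<longlongrightarrow> 0) at_top"
proof -
  obtain B where B: "\<And>x. \<bar>v x\<bar> \<le> B"
    using assms(3) by (auto simp: bounded_iff)
  show ?thesis
  proof (rule Lim_null_comparison)
    show "\<forall>\<^sub>F t in at_top. norm (\<gamma> powr t * v (X t)) \<le> \<gamma> powr t * B"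
      using B by (simp add: abs_mult mult_left_mono)
    show "((\<lambda>t. \<gamma> powr t * B) \<longlongrightarrow> 0) at_top"
      using tendsto_mult_left_zero[OF tendsto_powr_at_top_0[OF assms(1,2)]] .
  qed
qed

section \<open>Value functions and pointwise bounds on the Hamiltonian\<close>

context control_problem
begin

lemma policy_trajectory:
  assumes "is_policy U \<pi>"
  shows "is_policy_trajectory f \<pi> x (policy_trajectory f \<pi> x)"
  using policy_trajectory_unique[OF assms, of x]
  unfolding uniquely_defined_def policy_trajectory_def by (metis someI)

text \<open>Both claims share one setup: \<open>diff\<close> writes the gap between
  \<open>- w'\<close> and the discounted reward as a discounted Hamiltonian slack, whose sign or
  vanishing decides the claim.\<close>

lemma
  assumes \<gamma>: "0 < \<gamma>" "\<gamma> < 1" and \<pi>: "is_policy U \<pi>"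
    and v: "C1_function v" "bounded (range v)"
  shows value_function_le:
      "(\<And>x. hamiltonian f r x (\<pi> x) (gradient v x) \<le> - ln \<gamma> * v x)
        \<Longrightarrow> value_function f r \<gamma> \<pi> x \<le> ereal (v x)"
    and value_function_eq:
      "(\<And>x. hamiltonian f r x (\<pi> x) (gradient v x) = - ln \<gamma> * v x)
        \<Longrightarrow> value_function f r \<gamma> \<pi> x = ereal (v x)"
proof -
  define X where "X = policy_trajectory f \<pi> x"
  define g where "g = (\<lambda>t. \<gamma> powr t * r (X t) (\<pi> (X t)))"
  define w where "w = (\<lambda>t. \<gamma> powr t * v (X t))"
  define w' where
    "w' = (\<lambda>t. \<gamma> powr t * (ln \<gamma> * v (X t) + gradient v (X t) \<bullet> f (X t) (\<pi> (X t))))"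
  have X0: "X 0 = x"
    and X: "\<And>t. 0 \<le> t \<Longrightarrow> (X has_vector_derivative f (X t) (\<pi> (X t))) (at t within {0..})"
    using policy_trajectory[OF \<pi>, of x]
    by (auto simp: X_def is_policy_trajectory_def is_state_trajectory_def)
  have cX: "continuous_on {0..} X"
    using X by (auto simp: continuous_on_eq_continuous_within intro: has_vector_derivative_continuous)
  have c\<pi>: "continuous_on {0..} (\<lambda>t. \<pi> (X t))"
    using \<pi> by (intro continuous_on_compose2[OF _ cX, of UNIV]) (auto simp: is_policy_def)
  have \<pi>U: "\<pi> y \<in> U" for y
    using \<pi> by (simp add: is_policy_def)
  have "continuous_on {0..} (\<lambda>t. r (X t) (\<pi> (X t)))"
    using continuous_on_compose2[OF r_continuous continuous_on_Pair[OF cX c\<pi>]] \<pi>U by auto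
  then have g: "continuous_on {0..} g"
    unfolding g_def using \<gamma> by (auto intro!: continuous_intros)
  obtain M where M: "\<And>y u. u \<in> U \<Longrightarrow> r y u \<le> M"
    using r_attains_maximum
    by (fastforce simp: is_maximum_def is_arg_max_linorder)
  \<comment> \<open>The maximal reward gives an integrable majorant, which keeps the positive part
    of the reward integral finite.\<close>
  have gM: "g t \<le> M * \<gamma> powr t" for t
    using mult_left_mono[OF M[OF \<pi>U], of "\<gamma> powr t"] by (simp add: g_def mult.commute)
  have iM: "set_integrable lborel {0..} (\<lambda>t. M * \<gamma> powr t)"
    using set_integrable_discount[OF \<gamma>] by simp
  have w: "(w has_real_derivative w' t) (at t within {0..})" if "0 \<le> t" for t
    unfolding w_def w'_def using v \<gamma> X[OF that]
    by (intro has_real_derivative_discounted_trajectory) (auto simp: C1_function_def)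
  have lim: "(w \<longlongrightarrow> 0) at_top"
    unfolding w_def by (rule tendsto_discounted_bounded[OF \<gamma> v(2)])
  have w0: "w 0 = v x"
    using \<gamma> by (simp add: w_def X0)
  have val: "value_function f r \<gamma> \<pi> x = time_integral g"
    by (simp add: value_function_def Let_def g_def X_def)
  have diff: "- w' t - g t =
      \<gamma> powr t * (- ln \<gamma> * v (X t) - hamiltonian f r (X t) (\<pi> (X t)) (gradient v (X t)))" for t
    by (simp add: w'_def g_def hamiltonian_def algebra_simps)
  show "value_function f r \<gamma> \<pi> x \<le> ereal (v x)"
    if "\<And>x. hamiltonian f r x (\<pi> x) (gradient v x) \<le> - ln \<gamma> * v x"
  proof -
    have "0 \<le> - w' t - g t" for t
      unfolding diff using that[of "X t"] by (intro mult_nonneg_nonneg) auto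
    then have "time_integral g \<le> ereal (w 0)"
      by (intro time_integral_le[OF g gM iM w _ lim]) (auto simp: algebra_simps)
    then show ?thesis
      by (simp add: val w0)
  qed
  show "value_function f r \<gamma> \<pi> x = ereal (v x)"
    if "\<And>x. hamiltonian f r x (\<pi> x) (gradient v x) = - ln \<gamma> * v x"
  proof -
    have "w' t = - g t" for t
      using diff[of t] that[of "X t"] by simp
    then have "(w has_real_derivative - g t) (at t within {0..})" if "0 \<le> t" for t
      using w[OF that] by simp
    \<comment> \<open>This antiderivative of the majorant takes the role of \<open>P\<close> in
      \<open>time_integral_FTC\<close>; its limit is 0.\<close>
    moreover have "((\<lambda>t. M * (\<gamma> powr t / ln \<gamma>)) has_real_derivative M * \<gamma> powr t) (at t within {0..})" for t
      using DERIV_cmult[OF DERIV_cdivide[OF has_real_derivative_const_powr], of \<gamma> M "ln \<gamma>"] \<gamma> by simp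
    moreover have "((\<lambda>t. M * (\<gamma> powr t / ln \<gamma>)) \<longlongrightarrow> M * (0 / ln \<gamma>)) at_top"
      using \<gamma> by (intro tendsto_intros tendsto_powr_at_top_0) auto
    moreover have "continuous_on {0..} (\<lambda>t. M * \<gamma> powr t)"
      using \<gamma> by (auto intro!: continuous_intros)
    ultimately have "time_integral g = ereal (w 0)"
      using time_integral_FTC[OF g gM _ iM _ _ _ lim] by blast
    then show ?thesis
      by (simp add: val w0)
  qed
qed

section \<open>Consequences of the Hamilton--Jacobi--Bellman equation\<close>

lemma HJB_hamiltonian_le:
  assumes "HJB_solution U f r \<gamma> v" "u \<in> U"
  shows "hamiltonian f r x u (gradient v x) \<le> - ln \<gamma> * v x"
proof -
  obtain z where "is_arg_max (\<lambda>u. hamiltonian f r x u (gradient v x)) (\<lambda>u. u \<in> U) z"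
    and "hamiltonian f r x z (gradient v x) = - ln \<gamma> * v x"
    using assms(1) unfolding HJB_solution_def is_maximum_def by blast
  then show ?thesis
    using assms(2) unfolding is_arg_max_linorder by metis
qed

text \<open>The maximizer witnessing the equation may differ from \<open>u\<close>, but any two
  maximizers give the same value.\<close>

lemma HJB_hamiltonian_eq:
  assumes "HJB_solution U f r \<gamma> v"
    and "is_arg_max (\<lambda>u. hamiltonian f r x u (gradient v x)) (\<lambda>u. u \<in> U) u"
  shows "hamiltonian f r x u (gradient v x) = - ln \<gamma> * v x"
proof -
  obtain z where z: "is_arg_max (\<lambda>u. hamiltonian f r x u (gradient v x)) (\<lambda>u. u \<in> U) z"
    and "hamiltonian f r x z (gradient v x) = - ln \<gamma> * v x"
    using assms(1) unfolding HJB_solution_def is_maximum_def by blast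
  moreover have "hamiltonian f r x u (gradient v x) = hamiltonian f r x z (gradient v x)"
    using z assms(2) unfolding is_arg_max_linorder by (intro order_antisym) simp_all
  ultimately show ?thesis by simp
qed

lemma HJB_value_function_le:
  assumes "0 < \<gamma>" "\<gamma> < 1" "C1_function v" "bounded (range v)" "HJB_solution U f r \<gamma> v"
    and "is_policy U \<pi>"
  shows "value_function f r \<gamma> \<pi> x \<le> ereal (v x)"
proof (rule value_function_le[OF assms(1,2,6,3,4)])
  show "hamiltonian f r x (\<pi> x) (gradient v x) \<le> - ln \<gamma> * v x" for x
    using assms(6) by (intro HJB_hamiltonian_le[OF assms(5)]) (simp add: is_policy_def)
qed

lemma HJB_value_function_eq:
  assumes "0 < \<gamma>" "\<gamma> < 1" "C1_function v" "bounded (range v)" "HJB_solution U f r \<gamma> v"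
    and "is_policy U \<pi>"
    and "\<And>x. is_arg_max (\<lambda>u. hamiltonian f r x u (gradient v x)) (\<lambda>u. u \<in> U) (\<pi> x)"
  shows "value_function f r \<gamma> \<pi> x = ereal (v x)"
  by (rule value_function_eq[OF assms(1,2,6,3,4) HJB_hamiltonian_eq[OF assms(5,7)]])

text \<open>Maximizers chosen separately at each state need not form a continuous map. The jointly
  continuous selection, composed with the continuous gradient of \<open>v\<close>, does.\<close>

lemma maximizing_policy_exists:
  assumes "C1_function v"
  obtains \<pi> where "is_policy U \<pi>"
    "\<And>x. is_arg_max (\<lambda>u. hamiltonian f r x u (gradient v x)) (\<lambda>u. u \<in> U) (\<pi> x)"
proof -
  obtain u where u: "continuous_on UNIV (\<lambda>(x, p). u x p)"
    and max: "\<And>x p. is_arg_max (\<lambda>u. hamiltonian f r x u p) (\<lambda>u. u \<in> U) (u x p)"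
    using maximizer_exists by blast
  have "continuous_on UNIV (\<lambda>x. (x, gradient v x))"
    using assms by (auto simp: C1_function_def intro!: continuous_intros)
  from continuous_on_compose2[OF u this] have "continuous_on UNIV (\<lambda>x. u x (gradient v x))"
    by simp
  with max have "is_policy U (\<lambda>x. u x (gradient v x))"
    by (auto simp: is_policy_def is_arg_max_def)
  then show thesis
    using max that by blast
qed

text \<open>The policy is chosen to maximize for \<open>v\<close> alone, so its value is
  \<open>v\<close>; the solution \<open>w\<close> bounds the value of every policy. Exchanging the
  roles gives uniqueness.\<close>

lemma HJB_solution_le:
  assumes "0 < \<gamma>" "\<gamma> < 1"
    and "C1_function v" "bounded (range v)" "HJB_solution U f r \<gamma> v"
    and "C1_function w" "bounded (range w)" "HJB_solution U f r \<gamma> w"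
  shows "v x \<le> w x"
proof -
  obtain \<pi> where \<pi>: "is_policy U \<pi>"
    "\<And>x. is_arg_max (\<lambda>u. hamiltonian f r x u (gradient v x)) (\<lambda>u. u \<in> U) (\<pi> x)"
    using maximizing_policy_exists[OF assms(3)] by metis
  have "ereal (v x) = value_function f r \<gamma> \<pi> x"
    using HJB_value_function_eq[OF assms(1-5) \<pi>] by simp
  also have "\<dots> \<le> ereal (w x)"
    using HJB_value_function_le[OF assms(1,2,6-8) \<pi>(1)] .
  finally show ?thesis by simp
qed

end

section \<open>Optimality of maximizing policies and uniqueness of the bounded solution\<close>

theorem theoremE7:
  fixes U :: "(real ^ 'm) set"
    and f :: "real ^ 'l \<Rightarrow> real ^ 'm \<Rightarrow> real ^ 'l"
    and r :: "real ^ 'l \<Rightarrow> real ^ 'm \<Rightarrow> real"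
    and \<gamma> :: real
    and v_star :: "real ^ 'l \<Rightarrow> real"
  assumes "control_problem U f r \<gamma>"
    and "0 < \<gamma>" and "\<gamma> < 1"
    and "C1_function v_star" and "bounded (range v_star)"
    and "HJB_solution U f r \<gamma> v_star"
  shows "(\<forall>\<pi>_star.
            is_policy U \<pi>_star \<and>
            (\<forall>x. is_arg_max (\<lambda>u. hamiltonian f r x u (gradient v_star x)) (\<lambda>u. u \<in> U) (\<pi>_star x))
            \<longrightarrow>
            (\<exists>B::real. \<forall>x. \<bar>value_function f r \<gamma> \<pi>_star x\<bar> \<le> ereal B) \<and>
            admissible U f r \<gamma> \<pi>_star \<and>
            (\<forall>x. value_function f r \<gamma> \<pi>_star x = ereal (v_star x)) \<and>
            (\<forall>\<pi>. is_policy U \<pi> \<longrightarrow>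
               (\<forall>x. value_function f r \<gamma> \<pi> x \<le> value_function f r \<gamma> \<pi>_star x)))
         \<and> (\<forall>v. C1_function v \<and> bounded (range v) \<and> HJB_solution U f r \<gamma> v \<longrightarrow> v = v_star)"
proof (intro conjI allI impI)
  interpret control_problem U f r \<gamma> by fact
  note star = assms(2-6)
  obtain B where B: "\<And>x. \<bar>v_star x\<bar> \<le> B"
    using assms(5) by (auto simp: bounded_iff)
  fix \<pi>_star
  assume "is_policy U \<pi>_star \<and>
    (\<forall>x. is_arg_max (\<lambda>u. hamiltonian f r x u (gradient v_star x)) (\<lambda>u. u \<in> U) (\<pi>_star x))"
  then have policy: "is_policy U \<pi>_star"
    and "\<And>x. is_arg_max (\<lambda>u. hamiltonian f r x u (gradient v_star x)) (\<lambda>u. u \<in> U) (\<pi>_star x)"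
    by auto
  \<comment> \<open>This identity turns boundedness, finiteness and optimality of the value into
    statements about \<open>v_star\<close>.\<close>
  then have eq: "value_function f r \<gamma> \<pi>_star x = ereal (v_star x)" for x
    by (intro HJB_value_function_eq[OF star])
  then show "value_function f r \<gamma> \<pi>_star x = ereal (v_star x)" for x .
  show "\<exists>B::real. \<forall>x. \<bar>value_function f r \<gamma> \<pi>_star x\<bar> \<le> ereal B"
    using B by (auto simp: eq)
  show "admissible U f r \<gamma> \<pi>_star"
    using policy by (simp add: admissible_def eq)
  show "value_function f r \<gamma> \<pi> x \<le> value_function f r \<gamma> \<pi>_star x" if "is_policy U \<pi>" for \<pi> x
    using HJB_value_function_le[OF star that] by (simp add: eq)
next
  interpret control_problem U f r \<gamma> by fact
  fix v :: "real ^ 'l \<Rightarrow> real"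
  assume "C1_function v \<and> bounded (range v) \<and> HJB_solution U f r \<gamma> v"
  then have v: "C1_function v" "bounded (range v)" "HJB_solution U f r \<gamma> v"
    by auto
  show "v = v_star"
    using HJB_solution_le[OF assms(2,3) v assms(4-6)] HJB_solution_le[OF assms(2-6) v]
    by (intro ext order_antisym)
qed

end
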